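(* Let $n$ be a positive integer. Then $$\det\bigl(K_{i,j}\bigr)_{1\le i,j\le n}=4^{\frac{n(n-1)}{2}}\,n!,\qquad\text{where}\qquad K_{i,j}=\sum_{k=-n+1}^{n}k\binom{2j+k-3}{i-1}\binom{n}{j+k-1}.$$
   Context: Binomial coefficients: for an integer $N\ge 0$, $\binom{N}{m}=0$ if $m<0$ or $m>N$; in particular $\binom{n}{j+k-1}=0$ if $j+k-1<0$ or $j+k-1>n$. (A binomial coefficient $\binom{2j+k-3}{i-1}$ with negative upper entry occurs only multiplied by zero.) *)

theory Defs
  imports "Jordan_Normal_Form.Determinant"
begin

(* Binomial coefficient with integer arguments, zero outside 0 <= m <= N.
   The value for N < 0 is an arbitrary convention and never matters in K: when
   2 * j + k - 3 < 0 and j >= 1, either j + k - 1 < 0, so that the second binomial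
   coefficient vanishes, or j = 1 and k = 0, so that the factor k vanishes. *)
definition ibinom :: "int \<Rightarrow> int \<Rightarrow> int" where
  "ibinom N m = (if 0 \<le> m \<and> m \<le> N then int (nat N choose nat m) else 0)"

(* Entries are indexed from 1. *)
definition K :: "nat \<Rightarrow> nat \<Rightarrow> nat \<Rightarrow> int" where
  "K n i j = (\<Sum>k = - int n + 1..int n.
     k * ibinom (2 * int j + k - 3) (int i - 1) * ibinom (int n) (int j + k - 1))"

(* Matrices of Jordan_Normal_Form are indexed from 0, hence the shift. *)
definition K_mat :: "nat \<Rightarrow> int mat" where
  "K_mat n = mat n n (\<lambda>(i, j). K n (i + 1) (j + 1))"

end

theory Submission
  imports Defs "HOL-Computational_Algebra.Polynomial"
begin

text \<open>
  The proof reads each column of the matrix as the beginning of the coefficient sequence of a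
  polynomial. Number rows and columns from 0, so that column \<open>c\<close> stands for \<open>j = c + 1\<close>, and
  substitute \<open>m = j + k - 1\<close>. The entry in row \<open>r\<close> is then the coefficient of \<open>x\<^sup>r\<close> in
  \<open>(\<Sum>m\<le>n. (m - c) * (n choose m) * y^(c + m - 1))\<close> with \<open>y = 1 + x\<close>. The binomial theorem and its
  derivative sum this to \<open>(1 + y)^(n - 1) * ((n - c) * y^c - c * y^(c - 1))\<close>
  (lemma \<open>weighted_binomial_sum\<close>).

  The factor \<open>(1 + y)^(n - 1) = (2 + x)^(n - 1)\<close> is common to all columns, and the second factor has
  degree at most \<open>c\<close> in \<open>x\<close>. Multiplication by a fixed polynomial acts on the first \<open>n\<close> coefficients
  as a lower triangular Toeplitz matrix, here with diagonal entries \<open>2^(n - 1)\<close>; the coefficients of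
  the second factors form an upper triangular matrix with diagonal entries \<open>n - c\<close>
  (lemma \<open>det_coeffs_common_factor\<close>). Hence the determinant is
  \<open>(2^(n - 1))^n * (\<Prod>c<n. n - c) = 4^(n * (n - 1) / 2) * n!\<close>.
\<close>

lemma sum_binomial_times_index:
  fixes y :: "'a :: comm_ring_1"
  shows "(\<Sum>m\<le>Suc N. of_nat (Suc N choose m) * of_nat m * y ^ (c + m - 1))
           = of_nat (Suc N) * y ^ c * (1 + y) ^ N"
proof -
  have absorb: "of_nat (Suc N choose Suc m) * of_nat (Suc m) = (of_nat (Suc N) * of_nat (N choose m) :: 'a)"
    for m
    by (metis Suc_times_binomial mult.commute of_nat_mult)
  have "(\<Sum>m\<le>Suc N. of_nat (Suc N choose m) * of_nat m * y ^ (c + m - 1))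
      = (\<Sum>m\<le>N. of_nat (Suc N choose Suc m) * of_nat (Suc m) * y ^ (c + m))"
    by (subst sum.atMost_Suc_shift) simp
  also have "\<dots> = of_nat (Suc N) * y ^ c * (\<Sum>m\<le>N. of_nat (N choose m) * y ^ m)"
    by (simp only: absorb sum_distrib_left power_add) (simp only: mult_ac)
  also have "(\<Sum>m\<le>N. of_nat (N choose m) * y ^ m) = (1 + y) ^ N"
    using binomial_ring[of y 1 N] by (simp add: add.commute)
  finally show ?thesis .
qed

text \<open>
  The part of the weight \<open>m - c\<close> with \<open>m\<close> gives a derivative of the binomial theorem, the part with
  \<open>c\<close> the binomial theorem itself. Truncated subtraction spoils the exponents only at \<open>c = 0\<close>, where
  the factor in front of the power vanishes.
\<close>

lemma weighted_binomial_sum: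
  fixes y :: "'a :: comm_ring_1"
  assumes "n \<ge> 1"
  shows "(\<Sum>m\<le>n. of_nat (n choose m) * (of_nat m - of_nat c) * y ^ (c + m - 1))
           = (1 + y) ^ (n - 1) * ((of_nat n - of_nat c) * y ^ c - of_nat c * y ^ (c - 1))"
proof -
  obtain N where n: "n = Suc N"
    using assms by (cases n) auto
  have shift: "of_nat c * y ^ (c + m - 1) = of_nat c * y ^ (c - 1) * y ^ m" for m
    by (cases c) (simp_all add: power_add algebra_simps)
  have "(\<Sum>m\<le>n. of_nat (n choose m) * of_nat c * y ^ (c + m - 1))
      = of_nat c * y ^ (c - 1) * (\<Sum>m\<le>n. of_nat (n choose m) * y ^ m)"
    by (simp only: sum_distrib_left mult.assoc shift) (simp only: mult_ac)
  also have "(\<Sum>m\<le>n. of_nat (n choose m) * y ^ m) = (1 + y) ^ n"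
    using binomial_ring[of y 1 n] by (simp add: add.commute)
  finally have const: "(\<Sum>m\<le>n. of_nat (n choose m) * of_nat c * y ^ (c + m - 1))
      = of_nat c * y ^ (c - 1) * (1 + y) ^ n" .
  have drop: "of_nat c * (y ^ (c - 1) * y) = of_nat c * y ^ c"
    by (cases c) (simp_all add: mult.commute)
  have "(\<Sum>m\<le>n. of_nat (n choose m) * (of_nat m - of_nat c) * y ^ (c + m - 1))
      = of_nat n * y ^ c * (1 + y) ^ N - of_nat c * y ^ (c - 1) * (1 + y) ^ n"
    using sum_binomial_times_index[of N y c] const
    by (simp only: n right_diff_distrib left_diff_distrib sum_subtractf)
  also have "\<dots> = (1 + y) ^ N * (of_nat n * y ^ c - of_nat c * y ^ (c - 1) - of_nat c * (y ^ (c - 1) * y))"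
    unfolding n by (simp add: algebra_simps)
  also have "\<dots> = (1 + y) ^ (n - 1) * ((of_nat n - of_nat c) * y ^ c - of_nat c * y ^ (c - 1))"
    unfolding drop n by (simp add: algebra_simps)
  finally show ?thesis .
qed

text \<open>
  Taking the first \<open>n\<close> coefficients of \<open>p * q\<close> is a linear map applied to those of \<open>q\<close>, whose matrix
  is lower triangular with constant diagonal \<open>coeff p 0\<close>. The degree bound makes the matrix of the
  \<open>q c\<close> upper triangular.
\<close>

lemma det_coeffs_common_factor:
  fixes p :: "'a :: idom poly"
  assumes deg: "\<And>c. c < n \<Longrightarrow> degree (q c) \<le> c"
  shows "det (mat n n (\<lambda>(r, c). coeff (p * q c) r)) = coeff p 0 ^ n * (\<Prod>c<n. coeff (q c) c)"
proof -
  define T where "T = mat n n (\<lambda>(r, s). if s \<le> r then coeff p (r - s) else 0)"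
  define U where "U = mat n n (\<lambda>(s, c). coeff (q c) s)"
  have T: "T \<in> carrier_mat n n" and U: "U \<in> carrier_mat n n"
    by (simp_all add: T_def U_def)
  have "mat n n (\<lambda>(r, c). coeff (p * q c) r) = T * U"
  proof (rule eq_matI)
    fix r c assume "r < dim_row (T * U)" "c < dim_col (T * U)"
    then have r: "r < n" and c: "c < n"
      by (simp_all add: T_def U_def)
    have "coeff (p * q c) r = (\<Sum>s\<le>r. coeff p (r - s) * coeff (q c) s)"
      using coeff_mult[of "q c" p r] by (simp add: mult.commute)
    also have "\<dots> = (\<Sum>s = 0..<n. (if s \<le> r then coeff p (r - s) else 0) * coeff (q c) s)"
      by (rule sum.mono_neutral_cong_left) (use r in auto)
    also have "\<dots> = (T * U) $$ (r, c)"
      using r c by (simp add: T_def U_def scalar_prod_def)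
    finally show "mat n n (\<lambda>(r, c). coeff (p * q c) r) $$ (r, c) = (T * U) $$ (r, c)"
      using r c by simp
  qed (simp_all add: T_def U_def)
  moreover have "det T = coeff p 0 ^ n"
  proof -
    have "det T = prod_list (diag_mat T)"
      by (rule det_lower_triangular[OF _ T]) (simp add: T_def)
    then show ?thesis
      by (simp add: prod_list_diag_prod T_def)
  qed
  moreover have "det U = (\<Prod>c<n. coeff (q c) c)"
  proof -
    have "upper_triangular U"
      using deg by (auto simp: upper_triangular_def U_def intro!: coeff_eq_0 le_less_trans[OF deg])
    then have "det U = prod_list (diag_mat U)"
      by (rule det_upper_triangular[OF _ U])
    then show ?thesis
      by (simp add: prod_list_diag_prod U_def atLeast0LessThan)
  qed
  ultimately show ?thesis
    by (simp add: det_mult[OF T U])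
qed

lemma ibinom_of_nat: "ibinom (int N) (int m) = int (N choose m)"
  by (simp add: ibinom_def binomial_eq_0)

text \<open>
  The substitution \<open>m = j + k - 1\<close> turns the range of \<open>k\<close> into one that contains \<open>{0..n}\<close>, and outside
  of \<open>{0..n}\<close> the second binomial coefficient vanishes.
\<close>

lemma K_eq_sum:
  assumes "c < n"
  shows "K n (Suc r) (Suc c)
           = (\<Sum>m\<le>n. int (n choose m) * (int m - int c) * int ((c + m - 1) choose r))"
proof -
  define f where "f k = k * ibinom (2 * int (Suc c) + k - 3) (int (Suc r) - 1)
                          * ibinom (int n) (int (Suc c) + k - 1)" for k
  have "K n (Suc r) (Suc c) = sum f {- int n + 1..int n}"
    by (simp add: K_def f_def)
  also have "\<dots> = sum f ((\<lambda>m. int m - int c) ` {..n})"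
  proof (rule sum.mono_neutral_right)
    show "\<forall>k \<in> {- int n + 1..int n} - (\<lambda>m. int m - int c) ` {..n}. f k = 0"
    proof
      fix k assume k: "k \<in> {- int n + 1..int n} - (\<lambda>m. int m - int c) ` {..n}"
      have "\<not> (0 \<le> int c + k \<and> int c + k \<le> int n)"
      proof
        assume "0 \<le> int c + k \<and> int c + k \<le> int n"
        then have "k = int (nat (int c + k)) - int c" "nat (int c + k) \<in> {..n}"
          by auto
        with k show False by blast
      qed
      then show "f k = 0"
        by (auto simp: f_def ibinom_def)
    qed
  qed (use assms in auto)
  also have "\<dots> = (\<Sum>m\<le>n. f (int m - int c))"
    by (subst sum.reindex) (auto simp: inj_on_def)
  also have "\<dots> = (\<Sum>m\<le>n. int (n choose m) * (int m - int c) * int ((c + m - 1) choose r))"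
  proof (rule sum.cong)
    fix m assume "m \<in> {..n}"
    show "f (int m - int c) = int (n choose m) * (int m - int c) * int ((c + m - 1) choose r)"
    proof (cases "c + m = 0")
      \<comment> \<open>the only term with a negative upper entry\<close>
      case True
      then show ?thesis by (simp add: f_def)
    next
      case False
      then have upper: "2 * int (Suc c) + (int m - int c) - 3 = int (c + m - 1)"
        by (cases c; cases m) simp_all
      have lower: "int (Suc c) + (int m - int c) - 1 = int m" "int (Suc r) - 1 = int r"
        by simp_all
      show ?thesis
        by (simp only: f_def upper lower ibinom_of_nat) (simp only: mult_ac)
    qed
  qed simp
  finally show ?thesis .
qed

lemma coeff_one_plus_X_power: "coeff ([:1, 1:] ^ k) r = (of_nat (k choose r) :: 'a :: comm_ring_1)"
proof (cases "r \<le> k")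
  case True
  then show ?thesis by (simp add: coeff_linear_poly_power)
next
  case False
  then have "degree ([:1, 1 :: 'a:] ^ k) < r"
    using degree_power_le[of "[:1, 1 :: 'a:]" k] by simp
  then show ?thesis using False by (simp add: coeff_eq_0 binomial_eq_0)
qed

text \<open>
  The second factor of \<open>weighted_binomial_sum\<close> at \<open>y = 1 + x\<close>.
\<close>

definition column_poly :: "nat \<Rightarrow> nat \<Rightarrow> int poly" where
  "column_poly n c = smult (int n - int c) ([:1, 1:] ^ c) - smult (int c) ([:1, 1:] ^ (c - 1))"

lemma degree_column_poly: "degree (column_poly n c) \<le> c"
proof -
  have "degree ([:1, 1 :: int:] ^ k) \<le> k" for k
    using degree_power_le[of "[:1, 1 :: int:]" k] by simp
  then show ?thesis
    unfolding column_poly_def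
    by (intro degree_diff_le order_trans[OF degree_smult_le]) (auto intro: order_trans[OF _ diff_le_self])
qed

lemma lead_coeff_column_poly: "coeff (column_poly n c) c = int n - int c"
  by (cases c) (simp_all add: column_poly_def coeff_one_plus_X_power binomial_eq_0)

lemma K_eq_coeff:
  assumes "c < n"
  shows "K n (Suc r) (Suc c) = coeff ([:2, 1:] ^ (n - 1) * column_poly n c) r"
proof -
  let ?y = "[:1, 1 :: int:]"
  have "[:2, 1:] ^ (n - 1) * column_poly n c
      = (1 + ?y) ^ (n - 1) * ((of_nat n - of_nat c) * ?y ^ c - of_nat c * ?y ^ (c - 1))"
    by (simp add: column_poly_def of_nat_poly smult_diff_left one_pCons left_diff_distrib)
  also have "\<dots> = (\<Sum>m\<le>n. of_nat (n choose m) * (of_nat m - of_nat c) * ?y ^ (c + m - 1))"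
    using assms by (intro weighted_binomial_sum[symmetric]) simp
  also have "\<dots> = (\<Sum>m\<le>n. smult (int (n choose m) * (int m - int c)) (?y ^ (c + m - 1)))"
    by (simp add: of_nat_poly mult.commute[of "int (n choose _)"])
  finally show ?thesis
    using assms by (simp add: K_eq_sum coeff_sum coeff_one_plus_X_power)
qed

theorem corollary1p2:
  fixes n :: nat
  assumes "n \<ge> 1"
  shows "det (K_mat n) = 4 ^ (n * (n - 1) div 2) * fact n"
proof -
  have "K_mat n = mat n n (\<lambda>(r, c). coeff ([:2, 1:] ^ (n - 1) * column_poly n c) r)"
    unfolding K_mat_def by (rule cong_mat) (simp_all add: K_eq_coeff)
  then have "det (K_mat n) = coeff ([:2, 1:] ^ (n - 1)) 0 ^ n * (\<Prod>c<n. coeff (column_poly n c) c)"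
    by (simp only: det_coeffs_common_factor[OF degree_column_poly])
  also have "(\<Prod>c<n. coeff (column_poly n c) c) = (\<Prod>c<n. int (n - c))"
    by (rule prod.cong) (simp_all add: lead_coeff_column_poly of_nat_diff)
  also have "\<dots> = fact n"
    by (simp add: fact_prod_rev atLeast0LessThan)
  also have "coeff ([:2, 1 :: int:] ^ (n - 1)) 0 ^ n = 2 ^ (n * (n - 1))"
    by (simp add: coeff_0_power mult.commute flip: power_mult)
  also have "(2 :: int) ^ (n * (n - 1)) = 4 ^ (n * (n - 1) div 2)"
  proof -
    have "even (n * (n - 1))"
      by auto
    then have "(2 :: int) ^ (n * (n - 1)) = 2 ^ (2 * (n * (n - 1) div 2))"
      by (simp only: dvd_mult_div_cancel)
    also have "\<dots> = (2 ^ 2) ^ (n * (n - 1) div 2)"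
      by (rule power_mult)
    finally show ?thesis
      by simp
  qed
  finally show ?thesis .
qed

end
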